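(* Let $d\ge 2$ and let $\pmb{\xi}\in\mathbb{R}^d\setminus\mathbb{Q}^d$ satisfy $\xi_1^2+\dots+\xi_d^2=1$. Then for every $\varepsilon>0$ there exist arbitrarily large $T$ such that $T\cdot\Psi_{\pmb{\xi}}(T)\ge \frac14-\varepsilon$.
   Context: For $T\ge 1$, $\Psi_{\pmb{\xi}}(T)=\min \frac{|q\pmb{\xi}-\pmb{a}|^2}{q}$, the minimum taken over all $(q,a_1,\dots,a_d)\in\mathbb{Z}^{d+1}$ with $1\le q\le T$ and $a_1^2+\dots+a_d^2=q^2$, where $\pmb{a}=(a_1,\dots,a_d)$ and $|\cdot|$ denotes the Euclidean norm. *)

theory Defs
  imports "HOL-Analysis.Analysis"
begin

definition Psi_set :: "real ^ 'd \<Rightarrow> real \<Rightarrow> real set" where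
  "Psi_set \<xi> T =
     {(norm (real_of_int q *\<^sub>R \<xi> - (\<chi> i. real_of_int (a $ i))))\<^sup>2 / real_of_int q
        | (q :: int) (a :: int ^ 'd).
          1 \<le> q \<and> real_of_int q \<le> T \<and> (\<Sum>i\<in>UNIV. (a $ i)\<^sup>2) = q\<^sup>2}"

definition Psi :: "real ^ 'd \<Rightarrow> real \<Rightarrow> real" where
  "Psi \<xi> T = Min (Psi_set \<xi> T)"

text \<open>For \<open>T \<ge> 1\<close> the set is finite and nonempty, so that \<^const>\<open>Min\<close> is the genuine minimum.\<close>

lemma finite_Psi_set: "finite (Psi_set \<xi> T)"
proof -
  let ?B = "{- \<lfloor>T\<rfloor>..\<lfloor>T\<rfloor>}"
  let ?A = "vec_lambda ` {f :: 'a \<Rightarrow> int. f \<in> UNIV \<rightarrow>\<^sub>E ?B}"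
  let ?g = "\<lambda>(q, a :: int ^ 'a).
    (norm (real_of_int q *\<^sub>R \<xi> - (\<chi> i. real_of_int (a $ i))))\<^sup>2 / real_of_int q"
  have "finite ({f :: 'a \<Rightarrow> int. f \<in> UNIV \<rightarrow>\<^sub>E ?B})"
    using finite_PiE[of "UNIV :: 'a set" "\<lambda>_. ?B"] by simp
  then have fin: "finite ({1..\<lfloor>T\<rfloor>} \<times> ?A)"
    by blast
  have "Psi_set \<xi> T \<subseteq> ?g ` ({1..\<lfloor>T\<rfloor>} \<times> ?A)"
  proof
    fix x assume "x \<in> Psi_set \<xi> T"
    then obtain q and a :: "int ^ 'a" where x: "x = ?g (q, a)" and q: "1 \<le> q" "real_of_int q \<le> T"
      and s: "(\<Sum>i\<in>UNIV. (a $ i)\<^sup>2) = q\<^sup>2"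
      unfolding Psi_set_def by auto
    have qT: "q \<le> \<lfloor>T\<rfloor>" using q(2) by (simp add: le_floor_iff)
    have "\<bar>a $ i\<bar> \<le> \<lfloor>T\<rfloor>" for i
    proof -
      have "(a $ i)\<^sup>2 \<le> (\<Sum>i\<in>UNIV. (a $ i)\<^sup>2)"
        by (rule member_le_sum) auto
      then have "\<bar>a $ i\<bar> \<le> \<bar>q\<bar>" using s by (simp add: abs_le_square_iff)
      then show ?thesis using q(1) qT by linarith
    qed
    then have "vec_nth a \<in> UNIV \<rightarrow>\<^sub>E ?B" by (auto simp: PiE_UNIV_domain abs_le_iff minus_le_iff)
    then have "a \<in> ?A" by (metis (mono_tags, lifting) image_eqI mem_Collect_eq vec_nth_inverse)
    then show "x \<in> ?g ` ({1..\<lfloor>T\<rfloor>} \<times> ?A)" using x q(1) qT by auto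
  qed
  then show ?thesis using fin finite_surj by blast
qed

lemma Psi_set_nonempty:
  assumes "T \<ge> 1"
  shows "Psi_set \<xi> T \<noteq> {}"
proof -
  have "(\<Sum>i\<in>UNIV. ((axis undefined 1 :: int ^ 'a) $ i)\<^sup>2) = 1\<^sup>2"
    by (simp add: axis_def if_distrib[of "\<lambda>x. x\<^sup>2"] sum.delta cong: if_cong)
  then show ?thesis
    unfolding Psi_set_def using assms by fastforce
qed

end

theory Submission
  imports Defs
begin

text \<open>
  For integer null vectors \<open>(q, a)\<close>, \<open>(r, b)\<close> of the light cone, the Lorentz product
  \<open>q r - a \<bullet> b\<close> is a nonnegative integer vanishing only for proportional vectors, so distinct
  rational points \<open>a / q\<close>, \<open>b / r\<close> of the sphere satisfy \<open>\<bar>r a - q b\<bar>\<^sup>2 \<ge> 2 q r\<close>. If \<open>(r, b)\<close>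
  approximates \<open>\<xi>\<close> strictly better than \<open>(q, a)\<close>, where \<open>q \<le> r\<close>, the triangle inequality through
  \<open>\<xi>\<close> then shows that the deviation \<open>\<bar>q \<xi> - a\<bar>\<^sup>2 / q\<close> of the former is at least \<open>1 / (2 r)\<close>.
  If \<open>T \<cdot> \<Psi>(T)\<close> were eventually smaller than \<open>1/4\<close>, \<open>\<Psi>\<close> would tend to \<open>0\<close>, hence jump
  arbitrarily far out; just before a jump at \<open>r\<close>, at \<open>T = r - 1 \<ge> r / 2\<close>, one gets
  \<open>T \<cdot> \<Psi>(T) \<ge> 1/4\<close>, a contradiction.
\<close>

definition real_vec :: "int ^ 'd \<Rightarrow> real ^ 'd" where
  "real_vec a = (\<chi> i. real_of_int (a $ i))"

definition null_vec :: "int \<Rightarrow> int ^ 'd \<Rightarrow> bool" where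
  "null_vec q a \<longleftrightarrow> (\<Sum>i\<in>UNIV. (a $ i)\<^sup>2) = q\<^sup>2"

definition dev :: "real ^ 'd \<Rightarrow> int \<Rightarrow> int ^ 'd \<Rightarrow> real" where
  "dev \<xi> q a = (norm (real_of_int q *\<^sub>R \<xi> - real_vec a))\<^sup>2 / real_of_int q"

lemma Psi_set_eq:
  "Psi_set \<xi> T = {dev \<xi> q a | q a. 1 \<le> q \<and> real_of_int q \<le> T \<and> null_vec q a}"
  by (simp add: Psi_set_def dev_def real_vec_def null_vec_def)

lemma Psi_attained:
  assumes "T \<ge> 1"
  obtains q a where "1 \<le> q" "real_of_int q \<le> T" "null_vec q a" "Psi \<xi> T = dev \<xi> q a"
  using Min_in[OF finite_Psi_set Psi_set_nonempty[OF assms, of \<xi>]]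
  by (auto simp: Psi_set_eq Psi_def)

text \<open>Irrationality of some coordinate of \<xi> enters here; it makes the threshold
  \<open>m\<close> in the main argument positive.\<close>

lemma dev_pos:
  assumes "\<not> (\<forall>i. \<xi> $ i \<in> \<rat>)" "1 \<le> q"
  shows "dev \<xi> q a > 0"
proof -
  have "real_of_int q *\<^sub>R \<xi> \<noteq> real_vec a"
  proof
    assume eq: "real_of_int q *\<^sub>R \<xi> = real_vec a"
    have "\<xi> $ i = real_of_int (a $ i) / real_of_int q" for i
      using arg_cong[OF eq, of "\<lambda>v. v $ i"] assms(2) by (simp add: real_vec_def field_simps)
    then show False using assms(1) by simp
  qed
  then show ?thesis using assms(2) by (simp add: dev_def)
qed

lemma inner_real_vec: "real_vec a \<bullet> real_vec b = real_of_int (\<Sum>i\<in>UNIV. a $ i * b $ i)"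
  by (simp add: real_vec_def inner_vec_def)

lemma null_vec_separation:
  assumes a: "null_vec q a" and b: "null_vec r b" and pos: "1 \<le> q" "1 \<le> r"
    and ne: "real_of_int r *\<^sub>R real_vec a \<noteq> real_of_int q *\<^sub>R real_vec b"
  shows "2 * real_of_int q * real_of_int r
           \<le> (norm (real_of_int r *\<^sub>R real_vec a - real_of_int q *\<^sub>R real_vec b))\<^sup>2"
proof -
  define k where "k = q * r - (\<Sum>i\<in>UNIV. a $ i * b $ i)"
  have aa: "real_vec a \<bullet> real_vec a = (real_of_int q)\<^sup>2"
    and bb: "real_vec b \<bullet> real_vec b = (real_of_int r)\<^sup>2"
    using a b by (simp_all only: inner_real_vec null_vec_def power2_eq_square of_int_mult)
  have eq: "(norm (real_of_int r *\<^sub>R real_vec a - real_of_int q *\<^sub>R real_vec b))\<^sup>2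
          = 2 * real_of_int q * real_of_int r * real_of_int k" (is "?n = _")
    unfolding power2_norm_eq_inner inner_diff_left inner_diff_right inner_scaleR_left
      inner_scaleR_right aa bb inner_real_vec[of a b] inner_real_vec[of b a] k_def
    by (simp add: algebra_simps power2_eq_square)
  have c: "0 < 2 * real_of_int q * real_of_int r" using pos by simp
  \<comment> \<open>The sign of the Lorentz product \<open>k\<close> is read off from
    \<open>eq\<close>; integrality then lifts \<open>k > 0\<close> to
    \<open>k \<ge> 1\<close>.\<close>
  have "0 < ?n" using ne by simp
  then have "0 < real_of_int k" unfolding eq by (rule zero_less_mult_pos[OF _ c])
  then have "1 \<le> real_of_int k" by simp
  from mult_left_mono[OF this less_imp_le[OF c]] show ?thesis unfolding eq by (simp only: mult_1_right)
qed

lemma dev_lower_bound: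
  assumes a: "null_vec q a" and b: "null_vec r b" and q: "1 \<le> q" "q \<le> r"
    and less: "dev \<xi> r b < dev \<xi> q a"
  shows "1 / 2 \<le> real_of_int r * dev \<xi> q a"
proof -
  define x y where "x = real_of_int q" and "y = real_of_int r"
  define u v where "u = norm (x *\<^sub>R \<xi> - real_vec a)" and "v = norm (y *\<^sub>R \<xi> - real_vec b)"
  have xy: "0 < x" "x \<le> y" "0 < y" using q by (auto simp: x_def y_def)
  have uv: "0 \<le> u" "0 \<le> v" by (auto simp: u_def v_def)
  have less': "v\<^sup>2 / y < u\<^sup>2 / x"
    using less by (simp add: dev_def u_def v_def x_def y_def)
  then have lt: "x * v\<^sup>2 < y * u\<^sup>2" using xy by (simp add: field_simps)
  \<comment> \<open>Along a ray the deviation scales linearly with the denominator, so for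
    proportional vectors \<open>q \<le> r\<close> would contradict \<open>less\<close>.\<close>
  have ne: "y *\<^sub>R real_vec a \<noteq> x *\<^sub>R real_vec b"
  proof
    assume "y *\<^sub>R real_vec a = x *\<^sub>R real_vec b"
    then have "y *\<^sub>R (x *\<^sub>R \<xi> - real_vec a) = x *\<^sub>R (y *\<^sub>R \<xi> - real_vec b)"
      by (simp add: scaleR_diff_right mult.commute)
    from arg_cong[OF this, of norm] have yu: "y * u = x * v"
      using xy by (simp add: u_def v_def)
    have "x * (y * u\<^sup>2) \<le> y * (y * u\<^sup>2)"
      using xy by (intro mult_right_mono) auto
    also have "\<dots> = (y * u)\<^sup>2" by (simp add: power2_eq_square)
    also have "\<dots> = x * (x * v\<^sup>2)" unfolding yu by (simp add: power2_eq_square)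
    finally show False using lt xy by simp
  qed
  \<comment> \<open>The better approximation contributes at most as much as the worse one, so the
    triangle inequality below yields \<open>2 * (y * u)\<close>.\<close>
  have "(x * v)\<^sup>2 = x * (x * v\<^sup>2)" by (simp add: power2_eq_square)
  also have "\<dots> \<le> y * (y * u\<^sup>2)" using xy by (intro mult_mono less_imp_le[OF lt]) simp_all
  also have "\<dots> = (y * u)\<^sup>2" by (simp add: power2_eq_square)
  finally have xv: "x * v \<le> y * u" using xy uv by (simp add: power2_le_iff_abs_le)
  have "y *\<^sub>R real_vec a - x *\<^sub>R real_vec b
      = x *\<^sub>R (y *\<^sub>R \<xi> - real_vec b) - y *\<^sub>R (x *\<^sub>R \<xi> - real_vec a)"
    by (simp add: scaleR_diff_right mult.commute)
  then have "norm (y *\<^sub>R real_vec a - x *\<^sub>R real_vec b) \<le> x * v + y * u"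
    using norm_triangle_ineq4[of "x *\<^sub>R (y *\<^sub>R \<xi> - real_vec b)" "y *\<^sub>R (x *\<^sub>R \<xi> - real_vec a)"]
      xy by (simp add: u_def v_def)
  then have "norm (y *\<^sub>R real_vec a - x *\<^sub>R real_vec b) \<le> 2 * (y * u)" using xv by simp
  then have "(norm (y *\<^sub>R real_vec a - x *\<^sub>R real_vec b))\<^sup>2 \<le> (2 * (y * u))\<^sup>2"
    by (intro power_mono) auto
  moreover have "2 * x * y \<le> (norm (y *\<^sub>R real_vec a - x *\<^sub>R real_vec b))\<^sup>2"
    using null_vec_separation[OF a b] q ne by (simp add: x_def y_def)
  ultimately have "2 * x * y \<le> (2 * (y * u))\<^sup>2" by (rule order_trans[rotated])
  then have "(2 * y) * x \<le> (2 * y) * (2 * y * u\<^sup>2)"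
    by (simp add: power2_eq_square algebra_simps)
  then have "x \<le> 2 * y * u\<^sup>2" using xy by simp
  then show ?thesis using xy by (simp add: dev_def u_def x_def y_def field_simps)
qed

theorem theorem3:
  fixes \<xi> :: "real ^ 'd" and \<epsilon> :: real
  assumes "CARD('d) \<ge> 2"
    and "\<not> (\<forall>i. \<xi> $ i \<in> \<rat>)"
    and "(\<Sum>i\<in>UNIV. (\<xi> $ i)\<^sup>2) = 1"
    and "\<epsilon> > 0"
  shows "\<forall>T0 :: real. \<exists>T. T \<ge> T0 \<and> T \<ge> 1 \<and> T * Psi \<xi> T \<ge> 1 / 4 - \<epsilon>"
proof (rule allI, rule ccontr)
  fix T0 :: real
  assume "\<not> (\<exists>T. T \<ge> T0 \<and> T \<ge> 1 \<and> T * Psi \<xi> T \<ge> 1 / 4 - \<epsilon>)"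
  then have small: "T * Psi \<xi> T < 1 / 4" if "T \<ge> T0" "T \<ge> 1" for T
    using that \<open>\<epsilon> > 0\<close> by force
  define N where "N = max 1 \<lceil>T0\<rceil>"
  have N: "1 \<le> N" "T0 \<le> real_of_int N" unfolding N_def by linarith+
  define m where "m = Psi \<xi> (real_of_int N)"
  obtain q a where q: "1 \<le> q" "q \<le> N" and a: "null_vec q a" and m: "m = dev \<xi> q a"
    using Psi_attained[of "real_of_int N" \<xi>] N(1) unfolding m_def by auto
  have "m > 0" using dev_pos[OF assms(2) q(1)] m by simp
  define good where "good n \<longleftrightarrow> 1 \<le> n \<and> (\<exists>b. null_vec (int n) b \<and> dev \<xi> (int n) b < m)" for n
  \<comment> \<open>The bound \<open>1 / (4 * m)\<close> gives
    \<open>T * Psi \<xi> T < 1 / 4 \<le> T * m\<close>, forcing \<Psi> below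
    \<open>m\<close>.\<close>
  define T where "T = max (real_of_int N) (1 / (4 * m))"
  have T: "T0 \<le> T" "1 \<le> T" "1 / (4 * m) \<le> T" using N by (auto simp: T_def)
  have "T * Psi \<xi> T < T * m"
    using small[OF T(1,2)] T(3) \<open>m > 0\<close> by (simp add: field_simps)
  then have "Psi \<xi> T < m" using T(2) by simp
  then obtain p c where "1 \<le> p" "null_vec p c" "dev \<xi> p c < m"
    using Psi_attained[OF T(2), of \<xi>] by metis
  then have "good (nat p)" unfolding good_def by auto
  \<comment> \<open>The first denominator that beats \<open>m\<close>: the jump of \<Psi>.\<close>
  define n where "n = (LEAST n. good n)"
  have "good n" unfolding n_def using \<open>good (nat p)\<close> by (rule LeastI)
  then obtain b where b: "null_vec (int n) b" "dev \<xi> (int n) b < m" and "1 \<le> n"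
    by (auto simp: good_def)
  have before: "m \<le> dev \<xi> k c" if "1 \<le> k" "k < int n" "null_vec k c" for k c
  proof -
    have "nat k < n" using that(1,2) by linarith
    then have "\<not> good (nat k)" unfolding n_def by (rule not_less_Least)
    then show ?thesis using that by (auto simp: good_def)
  qed
  have "N < int n"
  proof (rule ccontr)
    assume "\<not> N < int n"
    then have "dev \<xi> (int n) b \<in> Psi_set \<xi> (real_of_int N)"
      unfolding Psi_set_eq using b(1) \<open>1 \<le> n\<close>
      by (intro CollectI exI[of _ "int n"] exI[of _ b]) auto
    then have "m \<le> dev \<xi> (int n) b" by (simp add: m_def Psi_def finite_Psi_set)
    then show False using b(2) by simp
  qed
  \<comment> \<open>Just before the jump, only denominators below \<open>n\<close> compete. Since
    \<open>n \<ge> 2\<close>, \<open>n \<le> 2 * S\<close>, which turns the bound 1/2 into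
    1/4.\<close>
  define S where "S = real n - 1"
  have S: "real_of_int N \<le> S" "real n \<le> 2 * S" using \<open>N < int n\<close> N(1) by (auto simp: S_def)
  obtain k c where k: "1 \<le> k" "real_of_int k \<le> S" "null_vec k c" "Psi \<xi> S = dev \<xi> k c"
    using Psi_attained[of S \<xi>] S(1) N(1) by auto
  have "k < int n" using k(2) by (simp add: S_def)
  then have "m \<le> Psi \<xi> S" using before k by simp
  have "1 / 2 \<le> real n * m"
    using dev_lower_bound[OF a b(1) q(1)] b(2) q(2) \<open>N < int n\<close> m by simp
  also have "\<dots> \<le> (2 * S) * Psi \<xi> S"
    using S \<open>m \<le> Psi \<xi> S\<close> \<open>m > 0\<close> N(1) by (intro mult_mono) auto
  finally have "1 / 4 \<le> S * Psi \<xi> S" by simp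
  moreover have "S * Psi \<xi> S < 1 / 4" using S(1) N by (intro small) auto
  ultimately show False by simp
qed

end
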